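(* Let $k \geq 4$ be an even integer, let $n\ge 1$, and let $\mathcal{P}$ be an $n$-polytope that is $(k-1)$-facet-colorable, with a proper coloring $\mu$ of its facet graph by colors in $\{1,\ldots,k-1\}$. Suppose that the complete graph $K_k$ has a perfect $1$-factorization $\{\sigma_1,\ldots,\sigma_{k-1}\}$. Then the edge-colored graph $\mathcal{G}$ constructed from $\mathcal{P}$, $\mu$ and $\sigma_1,\ldots,\sigma_{k-1}$ as described in the context is the flag graph of an $(n+1)$-polytope.
   Context: For an integer $n\ge 1$, an $n$-pre-maniplex is an $n$-regular simple graph (its nodes are called flags) whose edges are colored with $0,1,\ldots,n-1$ so that each flag is incident to exactly one edge of each color; $\Phi^i$ denotes the other endpoint of the edge of color $i$ at the flag $\Phi$. An $n$-maniplex is a connected $n$-pre-maniplex in which $(\Phi^i)^j=(\Phi^j)^i$ for every flag $\Phi$ and all colors $i,j$ with $|i-j|>1$. An $n$-polytope (identified with its flag graph) is an $n$-maniplex satisfying the Path Intersection Property: for every pair of flags $\Phi,\Psi$ and all colors $i\le j$, if there is a path from $\Phi$ to $\Psi$ using only colors in $\{i,\ldots,n-1\}$ and another path from $\Phi$ to $\Psi$ using only colors in $\{0,\ldots,j\}$, then there is a path from $\Phi$ to $\Psi$ using only colors in $\{i,\ldots,j\}$. The facets of an $n$-polytope are the connected components of the graph obtained by deleting all edges of color $n-1$. The facet graph of an $n$-polytope $\mathcal{P}$ is the simple graph whose nodes are the facets of $\mathcal{P}$, two nodes being adjacent if there is an edge of color $n-1$ in $\mathcal{P}$ between the corresponding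 facets. $\mathcal{P}$ is $(k-1)$-facet-colorable if its facet graph has a proper coloring with colors $1,\ldots,k-1$ (not all colors need be used). A perfect $1$-factorization of $K_k$ (with vertex set $\{1,\ldots,k\}$) is a partition of its edges into $k-1$ perfect matchings $\sigma_1,\ldots,\sigma_{k-1}$ such that the union of any two of them is a single cycle through all $k$ vertices. Regard each $\sigma_c$ as the fixed-point-free involution of $\{1,\ldots,k\}$ sending each vertex to its partner. Construction of $\mathcal{G}$: color each flag of $\mathcal{P}$ with the $\mu$-color of the facet containing it. Take $k$ disjoint copies $\mathcal{P}_1,\ldots,\mathcal{P}_k$ of $\mathcal{P}$ and write $\Phi_i$ for the copy in $\mathcal{P}_i$ of the flag $\Phi$. Keep all edges of colors $0,\ldots,n-1$ inside the copies, and for each flag $\Phi$ of $\mathcal{P}$, with $\mu$-color $c$ say, and each $i\in\{1,\ldots,k\}$, join $\Phi_i$ to $\Phi_{\sigma_c(i)}$ by an edge of color $n$. *)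

theory Defs
  imports Main "HOL-Library.Disjoint_Sets"
begin

record 'a ugraph =
  verts :: "'a set"
  edges :: "'a set set"

text \<open>The colour function is only meaningful on the edges of the graph.\<close>

record 'a cgraph = "'a ugraph" +
  colour :: "'a set \<Rightarrow> nat"

definition simple_graph :: "('a, 'b) ugraph_scheme \<Rightarrow> bool" where
  "simple_graph G \<longleftrightarrow> (\<forall>e \<in> edges G. e \<subseteq> verts G \<and> card e = 2)"

definition regular_graph :: "nat \<Rightarrow> ('a, 'b) ugraph_scheme \<Rightarrow> bool" where
  "regular_graph d G \<longleftrightarrow> (\<forall>x \<in> verts G. finite {e \<in> edges G. x \<in> e} \<and> card {e \<in> edges G. x \<in> e} = d)"

text \<open>There is a path (possibly of length zero) from \<open>x\<close> to \<open>y\<close>.\<close>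

definition joined :: "('a, 'b) ugraph_scheme \<Rightarrow> 'a \<Rightarrow> 'a \<Rightarrow> bool" where
  "joined G = (\<lambda>u v. {u, v} \<in> edges G)\<^sup>*\<^sup>*"

definition connected_graph :: "('a, 'b) ugraph_scheme \<Rightarrow> bool" where
  "connected_graph G \<longleftrightarrow> verts G \<noteq> {} \<and> (\<forall>x \<in> verts G. \<forall>y \<in> verts G. joined G x y)"

text \<open>Connected components are represented by their vertex sets.\<close>

definition components :: "('a, 'b) ugraph_scheme \<Rightarrow> 'a set set" where
  "components G = verts G // {(x, y). x \<in> verts G \<and> y \<in> verts G \<and> joined G x y}"

definition proper_colouring :: "('a, 'b) ugraph_scheme \<Rightarrow> nat set \<Rightarrow> ('a \<Rightarrow> nat) \<Rightarrow> bool" where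
  "proper_colouring G C f \<longleftrightarrow>
     (\<forall>x \<in> verts G. f x \<in> C) \<and>
     (\<forall>x \<in> verts G. \<forall>y \<in> verts G. {x, y} \<in> edges G \<longrightarrow> f x \<noteq> f y)"

definition restrict_colours :: "nat set \<Rightarrow> 'a cgraph \<Rightarrow> 'a cgraph" where
  "restrict_colours C G = G\<lparr>edges := {e \<in> edges G. colour G e \<in> C}\<rparr>"

definition pre_maniplex :: "nat \<Rightarrow> 'a cgraph \<Rightarrow> bool" where
  "pre_maniplex n G \<longleftrightarrow>
     1 \<le> n \<and> simple_graph G \<and> regular_graph n G \<and>
     (\<forall>e \<in> edges G. colour G e < n) \<and>
     (\<forall>x \<in> verts G. \<forall>i < n. \<exists>!e. e \<in> edges G \<and> x \<in> e \<and> colour G e = i)"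

definition adj_flag :: "'a cgraph \<Rightarrow> nat \<Rightarrow> 'a \<Rightarrow> 'a" where
  "adj_flag G i x = (THE y. {x, y} \<in> edges G \<and> colour G {x, y} = i)"

definition maniplex :: "nat \<Rightarrow> 'a cgraph \<Rightarrow> bool" where
  "maniplex n G \<longleftrightarrow>
     pre_maniplex n G \<and> connected_graph G \<and>
     (\<forall>x \<in> verts G. \<forall>i < n. \<forall>j < n. \<bar>int i - int j\<bar> > 1 \<longrightarrow>
        adj_flag G j (adj_flag G i x) = adj_flag G i (adj_flag G j x))"

definition path_intersection_property :: "nat \<Rightarrow> 'a cgraph \<Rightarrow> bool" where
  "path_intersection_property n G \<longleftrightarrow>
     (\<forall>x \<in> verts G. \<forall>y \<in> verts G. \<forall>j < n. \<forall>i \<le> j.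
        joined (restrict_colours {i..n - 1} G) x y \<and>
        joined (restrict_colours {0..j} G) x y \<longrightarrow>
        joined (restrict_colours {i..j} G) x y)"

text \<open>A polytope is identified with its flag graph.\<close>

definition flag_polytope :: "nat \<Rightarrow> 'a cgraph \<Rightarrow> bool" where
  "flag_polytope n G \<longleftrightarrow> maniplex n G \<and> path_intersection_property n G"

definition facets :: "nat \<Rightarrow> 'a cgraph \<Rightarrow> 'a set set" where
  "facets n P = components (restrict_colours (- {n - 1}) P)"

definition facet_containing :: "nat \<Rightarrow> 'a cgraph \<Rightarrow> 'a \<Rightarrow> 'a set" where
  "facet_containing n P x = (THE F. F \<in> facets n P \<and> x \<in> F)"

definition facet_graph :: "nat \<Rightarrow> 'a cgraph \<Rightarrow> 'a set ugraph" where
  "facet_graph n P =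
     \<lparr>verts = facets n P,
      edges = {{F, F'} | F F'. F \<in> facets n P \<and> F' \<in> facets n P \<and> F \<noteq> F' \<and>
                 (\<exists>x \<in> F. \<exists>y \<in> F'. {x, y} \<in> edges P \<and> colour P {x, y} = n - 1)}\<rparr>"

definition complete_graph :: "nat \<Rightarrow> nat ugraph" where
  "complete_graph k = \<lparr>verts = {1..k}, edges = {e. e \<subseteq> {1..k} \<and> card e = 2}\<rparr>"

definition perfect_matching :: "('a, 'b) ugraph_scheme \<Rightarrow> 'a set set \<Rightarrow> bool" where
  "perfect_matching G M \<longleftrightarrow> M \<subseteq> edges G \<and> (\<forall>v \<in> verts G. \<exists>!e. e \<in> M \<and> v \<in> e)"

text \<open>\<open>E\<close> is the edge set of a single cycle through all vertices of \<open>G\<close>.\<close>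

definition hamiltonian_cycle :: "('a, 'b) ugraph_scheme \<Rightarrow> 'a set set \<Rightarrow> bool" where
  "hamiltonian_cycle G E \<longleftrightarrow>
     E \<subseteq> edges G \<and>
     (\<exists>vs. 3 \<le> length vs \<and> distinct vs \<and> set vs = verts G \<and>
        E = {{vs ! i, vs ! (Suc i mod length vs)} | i. i < length vs})"

definition perfect_1_factorization :: "nat \<Rightarrow> (nat \<Rightarrow> nat set set) \<Rightarrow> bool" where
  "perfect_1_factorization k \<sigma> \<longleftrightarrow>
     inj_on \<sigma> {1..k - 1} \<and>
     partition_on (edges (complete_graph k)) (\<sigma> ` {1..k - 1}) \<and>
     (\<forall>c \<in> {1..k - 1}. perfect_matching (complete_graph k) (\<sigma> c)) \<and>
     (\<forall>c \<in> {1..k - 1}. \<forall>d \<in> {1..k - 1}. c \<noteq> d \<longrightarrow>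
        hamiltonian_cycle (complete_graph k) (\<sigma> c \<union> \<sigma> d))"

definition partner :: "'a set set \<Rightarrow> 'a \<Rightarrow> 'a" where
  "partner M v = (THE w. {v, w} \<in> M)"

text \<open>The pair \<open>(x, i)\<close> is the copy of the flag \<open>x\<close> in the \<open>i\<close>-th copy of \<open>P\<close>.\<close>

definition copied_edges :: "nat \<Rightarrow> 'a cgraph \<Rightarrow> ('a \<times> nat) set set" where
  "copied_edges k P = {{(x, i), (y, i)} | x y i. {x, y} \<in> edges P \<and> i \<in> {1..k}}"

definition matching_edges ::
  "nat \<Rightarrow> nat \<Rightarrow> 'a cgraph \<Rightarrow> ('a set \<Rightarrow> nat) \<Rightarrow> (nat \<Rightarrow> nat set set) \<Rightarrow> ('a \<times> nat) set set" where
  "matching_edges n k P \<mu> \<sigma> =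
     {{(x, i), (x, partner (\<sigma> (\<mu> (facet_containing n P x))) i)} | x i. x \<in> verts P \<and> i \<in> {1..k}}"

text \<open>If \<open>e\<close> is a copy of an edge of \<open>P\<close>, then that edge is \<open>fst ` e\<close>.\<close>

definition copies_graph ::
  "nat \<Rightarrow> nat \<Rightarrow> 'a cgraph \<Rightarrow> ('a set \<Rightarrow> nat) \<Rightarrow> (nat \<Rightarrow> nat set set) \<Rightarrow> ('a \<times> nat) cgraph" where
  "copies_graph n k P \<mu> \<sigma> =
     \<lparr>verts = verts P \<times> {1..k},
      edges = copied_edges k P \<union> matching_edges n k P \<mu> \<sigma>,
      colour = (\<lambda>e. if e \<in> copied_edges k P then colour P (fst ` e) else n)\<rparr>"

end

(* Every edge of G projects to an edge of P or to a single flag, and P embeds in G as each of the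
   k copies. A path avoiding colour n stays in one copy, so the path intersection property
   of G reduces to that of P. A flag x and its (n-1)-neighbour lie in different facets, by the path
   intersection property of P, hence have different mu-colours c and d; moving between the copies
   along these two flags realises every edge of the Hamiltonian cycle formed by sigma_c and sigma_d,
   so the copies are connected to each other. Colour n commutes with every i < n - 1 because an
   edge of such a colour stays within a facet. *)

theory Submission
  imports Defs
begin

section \<open>Paths\<close>

lemma joined_refl [simp]: "joined G x x"
  by (simp add: joined_def)

lemma joined_trans: "joined G x y \<Longrightarrow> joined G y z \<Longrightarrow> joined G x z"
  unfolding joined_def by (rule rtranclp_trans)

lemma joined_edge: "{x, y} \<in> edges G \<Longrightarrow> joined G x y"
  by (simp add: joined_def r_into_rtranclp)

lemma joined_sym: "joined G x y \<Longrightarrow> joined G y x"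
proof -
  have "symp (\<lambda>u v. {u, v} \<in> edges G)"
    by (auto intro!: sympI simp: insert_commute)
  then show "joined G x y \<Longrightarrow> joined G y x"
    unfolding joined_def by (meson sympD symp_rtranclp)
qed

text \<open>An edge may go to a path of any length, possibly a single vertex. The same lemma
  therefore serves for inclusions, for the embedding of \<open>P\<close> as a copy and for the
  projection that collapses edges of colour \<open>n\<close>.\<close>

lemma joined_map:
  assumes "\<And>u v. {u, v} \<in> edges G \<Longrightarrow> joined H (f u) (f v)" and "joined G x y"
  shows "joined H (f x) (f y)"
  using assms(2) unfolding joined_def
proof (induction rule: rtranclp_induct)
  case (step y z)
  then show ?case
    using assms(1) joined_trans unfolding joined_def by metis
qed simp

text \<open>The tool for ruling paths out: a function that no edge changes separates vertices with
  different values.\<close>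

lemma joined_invariant:
  assumes "\<And>u v. {u, v} \<in> edges G \<Longrightarrow> f u = f v" and "joined G x y"
  shows "f x = f y"
  using assms(2) unfolding joined_def
  by (induction rule: rtranclp_induct) (use assms(1) in auto)

lemma verts_restrict [simp]: "verts (restrict_colours C G) = verts G"
  by (simp add: restrict_colours_def)

lemma edges_restrict [simp]:
  "e \<in> edges (restrict_colours C G) \<longleftrightarrow> e \<in> edges G \<and> colour G e \<in> C"
  by (simp add: restrict_colours_def)

text \<open>The comparison of \<open>C\<close> with \<open>D\<close> concerns only colours that
  occur in \<open>G\<close>, so a bound on the colours can trim \<open>C\<close>.\<close>

lemma joined_restrict_mono:
  assumes "\<And>e. e \<in> edges G \<Longrightarrow> colour G e \<in> C \<Longrightarrow> colour G e \<in> D"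
    and "joined (restrict_colours C G) x y"
  shows "joined (restrict_colours D G) x y"
  by (rule joined_map[where f = "\<lambda>u. u", OF joined_edge assms(2)]) (use assms(1) in auto)

section \<open>Maniplexes and their facets\<close>

text \<open>Regularity comes from the other conditions: \<open>colour G\<close> maps the edges at a
  flag bijectively onto the \<open>n\<close> colours.\<close>

lemma pre_maniplexI:
  assumes "1 \<le> n" and "simple_graph G"
    and col: "\<And>e. e \<in> edges G \<Longrightarrow> colour G e < n"
    and ex1: "\<And>x i. x \<in> verts G \<Longrightarrow> i < n \<Longrightarrow> \<exists>!e. e \<in> edges G \<and> x \<in> e \<and> colour G e = i"
  shows "pre_maniplex n G"
proof -
  have "bij_betw (colour G) {e \<in> edges G. x \<in> e} {..<n}" if "x \<in> verts G" for x
    unfolding bij_betw_def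
  proof
    show "inj_on (colour G) {e \<in> edges G. x \<in> e}"
    proof (rule inj_onI)
      fix d e
      assume "d \<in> {e \<in> edges G. x \<in> e}" "e \<in> {e \<in> edges G. x \<in> e}" "colour G d = colour G e"
      then show "d = e"
        using ex1[OF that col, of e] by auto
    qed
    show "colour G ` {e \<in> edges G. x \<in> e} = {..<n}"
    proof
      show "{..<n} \<subseteq> colour G ` {e \<in> edges G. x \<in> e}"
        using ex1[OF that] by blast
    qed (use col in auto)
  qed
  then have "regular_graph n G"
    unfolding regular_graph_def by (fastforce dest: bij_betw_finite bij_betw_same_card)
  with assms show ?thesis
    unfolding pre_maniplex_def by blast
qed

lemma simple_graph_edgeD:
  assumes "simple_graph G" and "{x, y} \<in> edges G"
  shows "x \<in> verts G" and "y \<in> verts G" and "x \<noteq> y"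
proof -
  have "{x, y} \<subseteq> verts G" "card {x, y} = 2"
    using assms unfolding simple_graph_def by blast+
  then show "x \<in> verts G" and "y \<in> verts G" and "x \<noteq> y"
    by auto
qed

lemma simple_graph_edgeE:
  assumes "simple_graph G" and "e \<in> edges G" and "x \<in> e"
  obtains y where "e = {x, y}"
proof -
  have "card e = 2"
    using assms by (auto simp: simple_graph_def)
  with assms(3) that show thesis
    by (auto simp: card_2_iff insert_commute)
qed

lemma adj_flag_eqI:
  assumes "pre_maniplex n G" and "{x, y} \<in> edges G" and "colour G {x, y} = i"
  shows "adj_flag G i x = y"
  unfolding adj_flag_def
proof (rule the_equality)
  fix z
  assume z: "{x, z} \<in> edges G \<and> colour G {x, z} = i"
  have "x \<in> verts G" "i < n"
    using assms simple_graph_edgeD by (auto simp: pre_maniplex_def)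
  then have "\<exists>!e. e \<in> edges G \<and> x \<in> e \<and> colour G e = i"
    using assms(1) by (simp add: pre_maniplex_def)
  then have "{x, z} = {x, y}"
    using z assms(2,3) by blast
  then show "z = y"
    by (auto simp: doubleton_eq_iff)
qed (use assms in simp)

lemma adj_flag:
  assumes "pre_maniplex n G" and "x \<in> verts G" and "i < n"
  shows "{x, adj_flag G i x} \<in> edges G" and "colour G {x, adj_flag G i x} = i"
proof -
  obtain e where e: "e \<in> edges G" "x \<in> e" "colour G e = i"
    using assms unfolding pre_maniplex_def by blast
  moreover have "simple_graph G"
    using assms(1) by (simp add: pre_maniplex_def)
  ultimately obtain y where y: "e = {x, y}"
    by (elim simple_graph_edgeE)
  then have "adj_flag G i x = y"
    using adj_flag_eqI[OF assms(1)] e by blast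
  then show "{x, adj_flag G i x} \<in> edges G" and "colour G {x, adj_flag G i x} = i"
    using e y by auto
qed

lemma adj_flag_in_verts:
  assumes "pre_maniplex n G" and "x \<in> verts G" and "i < n"
  shows "adj_flag G i x \<in> verts G"
  using adj_flag(1)[OF assms] assms(1) simple_graph_edgeD(2) unfolding pre_maniplex_def by metis

lemma facet_containing_eq:
  assumes "x \<in> verts P"
  shows "facet_containing n P x =
    {y \<in> verts P. joined (restrict_colours (- {n - 1}) P) x y}"
  unfolding facet_containing_def
proof (rule the_equality)
  show "{y \<in> verts P. joined (restrict_colours (- {n - 1}) P) x y} \<in> facets n P
    \<and> x \<in> {y \<in> verts P. joined (restrict_colours (- {n - 1}) P) x y}"
    using assms by (auto simp: facets_def components_def quotient_def)
next
  fix F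
  assume "F \<in> facets n P \<and> x \<in> F"
  then show "F = {y \<in> verts P. joined (restrict_colours (- {n - 1}) P) x y}"
    by (auto simp: facets_def components_def quotient_def intro: joined_trans joined_sym)
qed

lemma facet_containing_in_facets:
  "x \<in> verts P \<Longrightarrow> facet_containing n P x \<in> facets n P"
  unfolding facet_containing_eq by (auto simp: facets_def components_def quotient_def)

lemma facet_containing_edge:
  assumes "simple_graph P" and "{x, y} \<in> edges P" and "colour P {x, y} \<noteq> n - 1"
  shows "facet_containing n P x = facet_containing n P y"
proof -
  have "joined (restrict_colours (- {n - 1}) P) x y"
    using assms by (intro joined_edge) simp
  then show ?thesis
    using simple_graph_edgeD[OF assms(1,2)]
    by (auto simp: facet_containing_eq intro: joined_trans joined_sym)
qed

text \<open>The facet graph has no loops, so a proper colouring says nothing about an edge of colour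
  \<open>n - 1\<close> inside one facet. Such an edge is excluded by the path intersection property:
  with \<open>i = j = n - 2\<close> it would force both ends to be joined by colour
  \<open>n - 2\<close> alone.\<close>

lemma facet_containing_adj_flag_neq:
  assumes P: "flag_polytope n P" and x: "x \<in> verts P"
  shows "facet_containing n P x \<noteq> facet_containing n P (adj_flag P (n - 1) x)"
proof
  let ?y = "adj_flag P (n - 1) x"
  have pre: "pre_maniplex n P" and n: "1 \<le> n" and simple: "simple_graph P"
    using P by (auto simp: flag_polytope_def maniplex_def pre_maniplex_def)
  have y: "?y \<in> verts P" and xy: "{x, ?y} \<in> edges P" "colour P {x, ?y} = n - 1"
    using adj_flag_in_verts[OF pre x] adj_flag[OF pre x] n by auto
  have neq: "x \<noteq> ?y"
    using simple_graph_edgeD(3)[OF simple xy(1)] .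
  assume "facet_containing n P x = facet_containing n P ?y"
  moreover have "?y \<in> facet_containing n P ?y"
    using y by (simp add: facet_containing_eq)
  ultimately have "?y \<in> facet_containing n P x"
    by simp
  then have *: "joined (restrict_colours (- {n - 1}) P) x ?y"
    using x by (simp add: facet_containing_eq)
  have less: "colour P e < n" if "e \<in> edges P" for e
    using pre that by (simp add: pre_maniplex_def)
  show False
  \<comment> \<open>For \<open>n = 1\<close> deleting the only colour leaves single flags as facets.
    This case is separate because \<open>n - 2\<close> would truncate to \<open>0\<close>, which is
    \<open>n - 1\<close>.\<close>
  proof (cases "n = 1")
    case True
    then have "\<And>u v. {u, v} \<in> edges (restrict_colours (- {n - 1}) P) \<Longrightarrow> u = v"
      using less by auto
    from joined_invariant[of _ "\<lambda>u. u", OF this *] neq show False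
      by simp
  next
    case False
    with n have n2: "2 \<le> n" by simp
    \<comment> \<open>All colours are below \<open>n\<close>, so avoiding \<open>n - 1\<close> means
      staying within \<open>{0..n - 2}\<close>.\<close>
    have "joined (restrict_colours {0..n - 2} P) x ?y"
      by (rule joined_restrict_mono[OF _ *]) (use less n2 in force)
    moreover have "joined (restrict_colours {n - 2..n - 1} P) x ?y"
      using xy by (intro joined_edge) auto
    moreover have "n - 2 < n"
      using n2 by simp
    ultimately have joined: "joined (restrict_colours {n - 2..n - 2} P) x ?y"
      using P x y unfolding flag_polytope_def path_intersection_property_def by blast
    define z where "z = adj_flag P (n - 2) x"
    have xz: "{x, z} \<in> edges P" "colour P {x, z} = n - 2"
      using adj_flag[OF pre x, of "n - 2"] n2 by (auto simp: z_def)
    have zx: "adj_flag P (n - 2) z = x"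
      using adj_flag_eqI[OF pre, of z x] xz by (simp add: insert_commute)
    \<comment> \<open>The edges of colour \<open>n - 2\<close> form a matching, so a path in that
      colour alone cannot leave the edge \<open>{x, z}\<close>.\<close>
    have "(u \<in> {x, z}) = (v \<in> {x, z})"
      if "{u, v} \<in> edges (restrict_colours {n - 2..n - 2} P)" for u v
    proof -
      have "adj_flag P (n - 2) u = v" "adj_flag P (n - 2) v = u"
        using that adj_flag_eqI[OF pre, of u v] adj_flag_eqI[OF pre, of v u]
        by (simp_all add: insert_commute)
      with zx z_def show ?thesis
        by (metis insert_iff singletonD)
    qed
    from joined_invariant[of _ "\<lambda>u. u \<in> {x, z}", OF this joined] neq have "?y = z"
      by auto
    \<comment> \<open>The edge \<open>{x, ?y}\<close> would have both colours \<open>n - 1\<close>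
      and \<open>n - 2\<close>, which differ for \<open>2 \<le> n\<close>.\<close>
    with xy xz n2 show False
      by simp
  qed
qed

section \<open>Perfect matchings\<close>

lemma partner_eqI:
  assumes "perfect_matching G M" and "v \<in> verts G" and "{v, w} \<in> M"
  shows "partner M v = w"
  unfolding partner_def
proof (rule the_equality)
  fix u
  assume "{v, u} \<in> M"
  with assms have "{v, u} = {v, w}"
    unfolding perfect_matching_def by blast
  then show "u = w"
    by (auto simp: doubleton_eq_iff)
qed fact

lemma partner_edge:
  assumes "simple_graph G" and "perfect_matching G M" and "v \<in> verts G"
  shows "{v, partner M v} \<in> M"
proof -
  obtain e where e: "e \<in> M" "v \<in> e"
    using assms unfolding perfect_matching_def by blast
  then obtain w where "e = {v, w}"
    using assms simple_graph_edgeE unfolding perfect_matching_def by (metis subsetD)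
  with e show ?thesis
    using partner_eqI[OF assms(2,3)] by auto
qed

lemma partner_properties:
  assumes "simple_graph G" and "perfect_matching G M" and "v \<in> verts G"
  shows "partner M v \<in> verts G" and "partner M v \<noteq> v" and "partner M (partner M v) = v"
proof -
  have "{v, partner M v} \<in> edges G"
    using partner_edge[OF assms] assms(2) by (auto simp: perfect_matching_def)
  from simple_graph_edgeD[OF assms(1) this]
  show "partner M v \<in> verts G" and "partner M v \<noteq> v" by auto
  then show "partner M (partner M v) = v"
    using partner_edge[OF assms] partner_eqI[OF assms(2)] by (simp add: insert_commute)
qed

text \<open>Walking along the list \<open>vs\<close> from its first entry reaches every
  vertex.\<close>

lemma hamiltonian_cycle_connected:
  assumes "hamiltonian_cycle G E" and "a \<in> verts G" and "b \<in> verts G"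
  shows "(\<lambda>u v. {u, v} \<in> E)\<^sup>*\<^sup>* a b"
proof -
  let ?H = "\<lparr>verts = verts G, edges = E\<rparr>"
  obtain vs where vs: "set vs = verts G"
    "E = {{vs ! i, vs ! (Suc i mod length vs)} | i. i < length vs}"
    using assms(1) unfolding hamiltonian_cycle_def by blast
  have *: "joined ?H (vs ! 0) (vs ! i)" if "i < length vs" for i
    using that
  proof (induction i)
    case (Suc i)
    \<comment> \<open>Here \<open>Suc i < length vs\<close>, so the \<open>mod\<close> does not wrap
      around.\<close>
    have "{vs ! i, vs ! (Suc i mod length vs)} \<in> E"
      unfolding vs(2) using Suc.prems Suc_lessD by blast
    then have "joined ?H (vs ! i) (vs ! Suc i)"
      using Suc.prems by (intro joined_edge) simp
    with Suc show ?case
      using joined_trans by fastforce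
  qed simp
  have "joined ?H a b"
    using assms(2,3) * joined_trans joined_sym unfolding vs(1)[symmetric] in_set_conv_nth by metis
  then show ?thesis
    by (simp add: joined_def)
qed

section \<open>The graph of copies\<close>

locale facet_coloured_polytope =
  fixes P :: "'a cgraph" and n k :: nat
    and \<mu> :: "'a set \<Rightarrow> nat" and \<sigma> :: "nat \<Rightarrow> nat set set"
  assumes k_pos: "1 \<le> k"
    and polytope: "flag_polytope n P"
    and colouring: "proper_colouring (facet_graph n P) {1..k - 1} \<mu>"
    and factorization: "perfect_1_factorization k \<sigma>"
begin

abbreviation G where "G \<equiv> copies_graph n k P \<mu> \<sigma>"

section \<open>Colours of flags and their involutions\<close>

definition flag_colour where "flag_colour x = \<mu> (facet_containing n P x)"

text \<open>The permutation of the copies along which edges of colour \<open>n\<close> at the flag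
  \<open>x\<close> run.\<close>

definition swap where "swap x a = partner (\<sigma> (flag_colour x)) a"

lemma P_props: "pre_maniplex n P" "simple_graph P" "connected_graph P" "1 \<le> n"
  using polytope by (auto simp: flag_polytope_def maniplex_def pre_maniplex_def)

lemma colour_less: "e \<in> edges P \<Longrightarrow> colour P e < n"
  using P_props(1) by (simp add: pre_maniplex_def)

lemmas edge_verts = simple_graph_edgeD[OF P_props(2)]

lemma flag_colour_range: "x \<in> verts P \<Longrightarrow> flag_colour x \<in> {1..k - 1}"
  using colouring facet_containing_in_facets[of x P n]
  by (simp add: proper_colouring_def facet_graph_def flag_colour_def)

lemma flag_colour_adj_neq:
  assumes x: "x \<in> verts P"
  shows "flag_colour x \<noteq> flag_colour (adj_flag P (n - 1) x)"
proof -
  let ?y = "adj_flag P (n - 1) x"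
  let ?F = "facet_containing n P x" and ?F' = "facet_containing n P ?y"
  have y: "?y \<in> verts P" and xy: "{x, ?y} \<in> edges P" "colour P {x, ?y} = n - 1"
    using adj_flag_in_verts[OF P_props(1) x] adj_flag[OF P_props(1) x] P_props(4) by auto
  have F: "?F \<in> facets n P" "?F' \<in> facets n P" "x \<in> ?F" "?y \<in> ?F'"
    using x y by (simp_all add: facet_containing_in_facets) (simp_all add: facet_containing_eq)
  then have "{?F, ?F'} \<in> edges (facet_graph n P)"
    using facet_containing_adj_flag_neq[OF polytope x] xy by (auto simp: facet_graph_def)
  moreover have "?F \<in> verts (facet_graph n P)" "?F' \<in> verts (facet_graph n P)"
    using F by (simp_all add: facet_graph_def)
  ultimately show ?thesis
    using colouring unfolding proper_colouring_def flag_colour_def by blast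
qed

lemma flag_colour_edge:
  "{x, y} \<in> edges P \<Longrightarrow> colour P {x, y} \<noteq> n - 1 \<Longrightarrow> flag_colour x = flag_colour y"
  using facet_containing_edge[OF P_props(2)] by (simp add: flag_colour_def)

lemma simple_complete_graph: "simple_graph (complete_graph k)"
  by (simp add: simple_graph_def complete_graph_def)

lemma verts_complete_graph: "verts (complete_graph k) = {1..k}"
  by (simp add: complete_graph_def)

lemma matching: "x \<in> verts P \<Longrightarrow> perfect_matching (complete_graph k) (\<sigma> (flag_colour x))"
  using factorization flag_colour_range by (simp add: perfect_1_factorization_def)

lemma swap_props:
  assumes "x \<in> verts P" and "a \<in> {1..k}"
  shows "swap x a \<in> {1..k}" and "swap x a \<noteq> a" and "swap x (swap x a) = a"
  using partner_properties[OF simple_complete_graph matching[OF assms(1)]] assms(2)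
  unfolding verts_complete_graph swap_def by blast+

section \<open>Edges of the graph of copies and their colours\<close>

lemma verts_G [simp]: "verts G = verts P \<times> {1..k}"
  by (simp add: copies_graph_def)

lemma copied_edges_iff:
  "{(x, a), (y, b)} \<in> copied_edges k P \<longleftrightarrow> {x, y} \<in> edges P \<and> a = b \<and> a \<in> {1..k}"
  by (auto simp: copied_edges_def doubleton_eq_iff insert_commute)

text \<open>The right-hand side treats \<open>a\<close> and \<open>b\<close> asymmetrically although
  an edge is unordered; this is sound because \<open>swap x\<close> is an involution.\<close>

lemma matching_edges_iff:
  "{(x, a), (y, b)} \<in> matching_edges n k P \<mu> \<sigma> \<longleftrightarrow>
     x = y \<and> x \<in> verts P \<and> a \<in> {1..k} \<and> b = swap x a" (is "?L \<longleftrightarrow> ?R")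
proof
  assume ?L
  then obtain z i where z: "{(x, a), (y, b)} = {(z, i), (z, swap z i)}" "z \<in> verts P" "i \<in> {1..k}"
    by (auto simp: matching_edges_def swap_def flag_colour_def)
  then show ?R
    using swap_props[OF z(2,3)] by (auto simp: doubleton_eq_iff)
next
  assume ?R
  then show ?L
    by (auto simp: matching_edges_def swap_def flag_colour_def)
qed

lemma edges_G_iff:
  "{(x, a), (y, b)} \<in> edges G \<longleftrightarrow>
     ({x, y} \<in> edges P \<and> a = b \<and> a \<in> {1..k}) \<or>
     (x = y \<and> x \<in> verts P \<and> a \<in> {1..k} \<and> b = swap x a)"
  using copied_edges_iff matching_edges_iff by (simp add: copies_graph_def)

lemma colour_G: "colour G {(x, a), (y, b)} =
    (if {x, y} \<in> edges P \<and> a = b \<and> a \<in> {1..k} then colour P {x, y} else n)"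
  using copied_edges_iff[of x a y b] by (simp add: copies_graph_def)

lemma colour_G_copy [simp]:
  "{x, y} \<in> edges P \<Longrightarrow> a \<in> {1..k} \<Longrightarrow> colour G {(x, a), (y, a)} = colour P {x, y}"
  by (simp add: colour_G)

text \<open>\<open>P\<close> has no loops, so a pair over a single flag is never a copied edge and
  receives the default colour \<open>n\<close>.\<close>

lemma colour_G_swap [simp]: "colour G {(x, a), (x, b)} = n"
  using edge_verts(3)[of x x] by (auto simp: colour_G)

lemma edges_G_cases:
  assumes "e \<in> edges G"
  obtains (copy) x y a where "e = {(x, a), (y, a)}" "{x, y} \<in> edges P" "a \<in> {1..k}"
  | (swap) x a where "e = {(x, a), (x, swap x a)}" "x \<in> verts P" "a \<in> {1..k}"
  using assms unfolding copies_graph_def copied_edges_def matching_edges_def swap_def flag_colour_def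
  by auto

lemma simple_G: "simple_graph G"
  unfolding simple_graph_def
proof (intro ballI conjI)
  fix e assume "e \<in> edges G"
  then show "e \<subseteq> verts G"
    by (cases rule: edges_G_cases) (use edge_verts swap_props in auto)
  from \<open>e \<in> edges G\<close> show "card e = 2"
  proof (cases rule: edges_G_cases)
    case (swap x a)
    then have "swap x a \<noteq> a"
      using swap_props(2) by blast
    with swap(1) show ?thesis
      by (auto simp: card_insert_if)
  qed (use edge_verts in \<open>auto simp: card_insert_if\<close>)
qed

section \<open>Regularity and neighbours in the graph of copies\<close>

lemma pre_maniplex_G: "pre_maniplex (n + 1) G"
proof (rule pre_maniplexI)
  show "colour G e < n + 1" if "e \<in> edges G" for e
    using that by (cases rule: edges_G_cases) (auto simp: less_Suc_eq colour_less)
next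
  fix u i
  assume "u \<in> verts G" and i: "i < n + 1"
  then obtain x a where u: "u = (x, a)" and x: "x \<in> verts P" and a: "a \<in> {1..k}"
    by auto
  define v where "v = (if i = n then (x, swap x a) else (adj_flag P i x, a))"
  have "{u, v} \<in> edges G \<and> u \<in> {u, v} \<and> colour G {u, v} = i"
    using x a i adj_flag[OF P_props(1) x, of i] by (auto simp: u v_def edges_G_iff)
  moreover have "e = {u, v}" if e: "e \<in> edges G \<and> u \<in> e \<and> colour G e = i" for e
  proof -
    obtain w where w: "e = {u, w}"
      using e simple_graph_edgeE[OF simple_G] by blast
    obtain y b where y: "w = (y, b)"
      by force
    show ?thesis
    \<comment> \<open>An edge over an edge of \<open>P\<close> must be a copied edge, since matching
      edges lie over a single flag; any other edge is a matching edge and has colour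
      \<open>n\<close>.\<close>
    proof (cases "{x, y} \<in> edges P")
      case True
      then have "x \<noteq> y"
        using edge_verts by blast
      with True e have "a = b" "colour P {x, y} = i"
        by (auto simp: w u y edges_G_iff)
      moreover have "i \<noteq> n"
        using colour_less[OF True] calculation by simp
      ultimately show ?thesis
        using adj_flag_eqI[OF P_props(1) True] by (auto simp: w u y v_def)
    next
      case False
      with e show ?thesis
        by (auto simp: w u y v_def edges_G_iff)
    qed
  qed
  ultimately show "\<exists>!e. e \<in> edges G \<and> u \<in> e \<and> colour G e = i"
    by blast
qed (simp_all add: simple_G)

lemma adj_flag_G:
  assumes "x \<in> verts P" and "a \<in> {1..k}"
  shows "i < n \<Longrightarrow> adj_flag G i (x, a) = (adj_flag P i x, a)"
    and "adj_flag G n (x, a) = (x, swap x a)"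
proof -
  show "adj_flag G i (x, a) = (adj_flag P i x, a)" if "i < n"
    using adj_flag[OF P_props(1) assms(1) that] assms(2)
    by (intro adj_flag_eqI[OF pre_maniplex_G]) (simp_all add: edges_G_iff)
  show "adj_flag G n (x, a) = (x, swap x a)"
    using assms by (intro adj_flag_eqI[OF pre_maniplex_G]) (simp_all add: edges_G_iff)
qed

section \<open>Lifting paths to a copy and projecting them to \<open>P\<close>\<close>

lemma joined_copy:
  assumes "a \<in> {1..k}" and "joined (restrict_colours C P) x y"
  shows "joined (restrict_colours C G) (x, a) (y, a)"
  by (rule joined_map[where f = "\<lambda>x. (x, a)", OF joined_edge assms(2)])
    (use assms(1) in \<open>simp add: edges_G_iff\<close>)

text \<open>A copied edge keeps its colour under \<open>fst\<close>, and a matching edge collapses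
  to a flag.\<close>

lemma joined_project:
  assumes "joined (restrict_colours C G) (x, a) (y, b)"
  shows "joined (restrict_colours C P) x y"
proof -
  have "joined (restrict_colours C P) (fst u) (fst v)"
    if "{u, v} \<in> edges (restrict_colours C G)" for u v
    using that by (cases u; cases v) (auto simp: edges_G_iff intro: joined_edge)
  from joined_map[of _ _ fst, OF this assms] show ?thesis
    by simp
qed

text \<open>Only edges of colour \<open>n\<close> change the second component.\<close>

lemma joined_same_copy:
  assumes "joined (restrict_colours C G) (x, a) (y, b)" and "n \<notin> C"
  shows "a = b"
proof -
  have "snd u = snd v" if "{u, v} \<in> edges (restrict_colours C G)" for u v
    using that assms(2) by (cases u; cases v) (auto simp: edges_G_iff)
  from joined_invariant[of _ snd, OF this assms(1)] show ?thesis
    by simp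
qed

section \<open>Connectedness\<close>

lemma joined_G_same_copy:
  assumes "a \<in> {1..k}" and "x \<in> verts P" and "y \<in> verts P"
  shows "joined G (x, a) (y, a)"
proof -
  have "joined P x y"
    using P_props(3) assms by (simp add: connected_graph_def)
  then show ?thesis
    by (rule joined_map[where f = "\<lambda>x. (x, a)", rotated])
      (use assms(1) in \<open>simp add: joined_edge edges_G_iff\<close>)
qed

text \<open>A detour makes the matching of \<open>y\<close> usable at \<open>x\<close>: go from
  \<open>x\<close> to \<open>y\<close> in copy \<open>a\<close>, cross to copy \<open>b\<close> at
  \<open>y\<close>, and return to \<open>x\<close> there.\<close>

lemma joined_G_matching:
  assumes x: "x \<in> verts P" and y: "y \<in> verts P" and ab: "{a, b} \<in> \<sigma> (flag_colour y)"
  shows "joined G (x, a) (x, b)"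
proof -
  have "{a, b} \<in> edges (complete_graph k)"
    using matching[OF y] ab by (auto simp: perfect_matching_def)
  then have a: "a \<in> {1..k}" and b: "b \<in> {1..k}"
    using simple_graph_edgeD[OF simple_complete_graph] by (auto simp: verts_complete_graph)
  have "swap y a = b"
    using partner_eqI[OF matching[OF y] _ ab] a by (simp add: swap_def verts_complete_graph)
  then have "joined G (y, a) (y, b)"
    using y a by (intro joined_edge) (simp add: edges_G_iff)
  then show ?thesis
    using joined_G_same_copy[OF a x y] joined_G_same_copy[OF b y x] joined_trans by metis
qed

lemma joined_G_across:
  assumes x: "x \<in> verts P" and a: "a \<in> {1..k}" and b: "b \<in> {1..k}"
  shows "joined G (x, a) (x, b)"
proof -
  \<comment> \<open>The matching of \<open>x\<close> alone only pairs up the copies; this neighbour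
    supplies a second colour, and perfectness of the factorization makes the two matchings a single
    cycle.\<close>
  let ?y = "adj_flag P (n - 1) x"
  let ?E = "\<sigma> (flag_colour x) \<union> \<sigma> (flag_colour ?y)"
  have y: "?y \<in> verts P"
    using adj_flag_in_verts[OF P_props(1) x] P_props(4) by simp
  have "hamiltonian_cycle (complete_graph k) ?E"
    using factorization flag_colour_range[OF x] flag_colour_range[OF y] flag_colour_adj_neq[OF x]
    unfolding perfect_1_factorization_def by blast
  then have "(\<lambda>u v. {u, v} \<in> ?E)\<^sup>*\<^sup>* a b"
    by (rule hamiltonian_cycle_connected) (use a b in \<open>simp_all only: verts_complete_graph\<close>)
  then show ?thesis
  proof (induction rule: rtranclp_induct)
    case (step c d)
    then have "joined G (x, c) (x, d)"
      using joined_G_matching[OF x x] joined_G_matching[OF x y] by blast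
    with step.IH show ?case
      by (rule joined_trans)
  qed simp
qed

lemma connected_G: "connected_graph G"
  unfolding connected_graph_def
proof (intro conjI ballI)
  show "verts G \<noteq> {}"
    using P_props(3) k_pos by (simp add: connected_graph_def)
  fix u v
  assume "u \<in> verts G" "v \<in> verts G"
  then show "joined G u v"
    using joined_trans[OF joined_G_same_copy joined_G_across] by auto
qed

section \<open>Commutation of distant colours\<close>

lemma swap_adj_flag:
  assumes "x \<in> verts P" and "i < n - 1"
  shows "swap (adj_flag P i x) = swap x"
  \<comment> \<open>An edge of colour \<open>i < n - 1\<close> stays inside a facet, so both its
    ends have the same colour and the same matching.\<close>
  using adj_flag[OF P_props(1) assms(1), of i] flag_colour_edge[of x "adj_flag P i x"] assms(2)
  by (auto simp: swap_def)

lemma maniplex_G: "maniplex (n + 1) G"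
  unfolding maniplex_def
proof (intro conjI ballI allI impI pre_maniplex_G connected_G)
  fix u i j
  assume "u \<in> verts G" and ij: "i < n + 1" "j < n + 1" "1 < \<bar>int i - int j\<bar>"
  then obtain x a where u: "u = (x, a)" and x: "x \<in> verts P" and a: "a \<in> {1..k}"
    by auto
  have verts: "adj_flag P l x \<in> verts P" if "l < n" for l
    using adj_flag_in_verts[OF P_props(1) x that] .
  have comm_n: "adj_flag G n (adj_flag G l u) = adj_flag G l (adj_flag G n u)" if "l < n - 1" for l
    using that x a verts[of l] swap_adj_flag[OF x that] swap_props(1)[OF x a]
    by (simp add: u adj_flag_G)
  \<comment> \<open>If one colour is \<open>n\<close>, a gap larger than \<open>1\<close> puts the
    other below \<open>n - 1\<close>, where \<open>comm_n\<close> applies.\<close>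
  consider "i < n" "j < n" | "i = n" "j < n - 1" | "j = n" "i < n - 1"
    using ij by linarith
  then show "adj_flag G j (adj_flag G i u) = adj_flag G i (adj_flag G j u)"
  proof cases
    case 1
    then have "adj_flag P j (adj_flag P i x) = adj_flag P i (adj_flag P j x)"
      using polytope x ij(3) unfolding flag_polytope_def maniplex_def by blast
    with 1 show ?thesis
      using x a verts by (simp add: u adj_flag_G)
  qed (use comm_n in auto)
qed

section \<open>Path intersection property\<close>

lemma path_intersection_G: "path_intersection_property (n + 1) G"
  unfolding path_intersection_property_def
proof (intro ballI allI impI)
  fix u v j i
  assume "u \<in> verts G" and "v \<in> verts G" and "j < n + 1" and ij: "i \<le> j"
    and *: "joined (restrict_colours {i..n + 1 - 1} G) u v \<and> joined (restrict_colours {0..j} G) u v"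
  then obtain x a y b where u: "u = (x, a)" and x: "x \<in> verts P" and a: "a \<in> {1..k}"
    and v: "v = (y, b)" and y: "y \<in> verts P"
    by auto
  show "joined (restrict_colours {i..j} G) u v"
  proof (cases "j = n")
    \<comment> \<open>For \<open>j = n\<close> the first of the two given paths is already the
      required one.\<close>
    case True
    with * show ?thesis by simp
  next
    case False
    with \<open>j < n + 1\<close> have j: "j < n" by simp
    \<comment> \<open>The path with colours in \<open>{0..j}\<close> avoids \<open>n\<close>, so its
      ends lie in one copy. The other path may change copies, but its projection to \<open>P\<close>
      has no edge of colour \<open>n\<close>.\<close>
    then have "a = b"
      using joined_same_copy[of "{0..j}" x a y b] * by (simp add: u v)
    have 1: "joined (restrict_colours {0..j} P) x y"
      using * joined_project[of _ x a y b] by (simp add: u v)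
    have "joined (restrict_colours {i..n} P) x y"
      using * joined_project[of _ x a y b] by (simp add: u v)
    then have "joined (restrict_colours {i..n - 1} P) x y"
      by (rule joined_restrict_mono[rotated]) (use colour_less in force)
    with 1 have "joined (restrict_colours {i..j} P) x y"
      using polytope x y j ij unfolding flag_polytope_def path_intersection_property_def by blast
    \<comment> \<open>The path found in \<open>P\<close> is lifted back into copy
      \<open>a\<close>.\<close>
    then show ?thesis
      using joined_copy[OF a] \<open>a = b\<close> by (simp add: u v)
  qed
qed

end

theorem theorem3p14:
  fixes P :: "'a cgraph" and n k :: nat
    and \<mu> :: "'a set \<Rightarrow> nat" and \<sigma> :: "nat \<Rightarrow> nat set set"
  assumes "4 \<le> k" and "even k" and "1 \<le> n"
    and "flag_polytope n P"
    and "proper_colouring (facet_graph n P) {1..k - 1} \<mu>"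
    and "perfect_1_factorization k \<sigma>"
  shows "flag_polytope (n + 1) (copies_graph n k P \<mu> \<sigma>)"
proof -
  interpret facet_coloured_polytope P n k \<mu> \<sigma>
    using assms by unfold_locales auto
  show ?thesis
    unfolding flag_polytope_def using maniplex_G path_intersection_G by blast
qed

end
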